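(* Let $V$ be an $\mathbb{R}$-vector space, let $\tau$ be a locally convex topology on $V$ generated by a directed family $\mathcal{S}$ of seminorms on $V$, and let $\overline{\tau}$ be the locally multiplicatively convex topology on the symmetric algebra $S(V)$ generated by the family of seminorms $\overline{i\rho}$, $\rho\in\mathcal{S}$, $i\in\{1,2,3,\dots\}$. Then $\overline{\tau}$ extends $\tau$ (i.e. the topology induced by $\overline{\tau}$ on $V=S(V)_1\subseteq S(V)$ is $\tau$), and $\overline{\tau}$ is the finest locally multiplicatively convex topology on $S(V)$ with this property.
   Context: $S(V)=\bigoplus_{k\ge0}S(V)_k$ is the symmetric algebra of $V$ (a commutative unital graded $\mathbb{R}$-algebra with $S(V)_0=\mathbb{R}$, $S(V)_1=V$). Seminorms take values in $[0,\infty)$; a seminorm $\sigma$ on an algebra is submultiplicative if $\sigma(ab)\le\sigma(a)\sigma(b)$. For a seminorm $\rho$ on $V$, set $\overline{\rho}_0:=|\cdot|$ on $\mathbb{R}$, and for $k\ge1$, $f\in S(V)_k$, $$\overline{\rho}_k(f):=\inf\Big\{\sum_{i=1}^n\rho(f_{i1})\cdots\rho(f_{ik}):f=\sum_{i=1}^nf_{i1}\cdots f_{ik},\ f_{ij}\in V,\ n\ge1\Big\}.$$ The projective extension of $\rho$ is the (submultiplicative) seminorm on $S(V)$ given by $\overline{\rho}(f):=\sum_k\overline{\rho}_k(f_k)$ for $f=\sum_kf_k$, $f_k\in S(V)_k$; $\overline{i\rho}$ denotes the projective extension of the seminorm $i\rho$. A locally convex topology on a real vector space is the one generated by some family of seminorms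 (not required to be Hausdorff); a locally multiplicatively convex topology on an $\mathbb{R}$-algebra is the one generated by some family of submultiplicative seminorms. $\mathcal{S}$ is directed if it is non-empty and for all $\rho_1,\rho_2\in\mathcal{S}$ there are $\rho\in\mathcal{S}$ and $C>0$ with $C\rho\ge\max\{\rho_1,\rho_2\}$ on $V$. *)

theory Defs
  imports "HOL-Analysis.Analysis" "HOL-Library.Poly_Mapping"
    "HOL-Library.Multiset"
begin

section \<open>The symmetric algebra of a real vector space\<close>

text \<open>
  The type of finitely supported maps from multisets over \<open>V\<close> to the reals is the free
  commutative unital real algebra on the set \<open>V\<close>; the multiset \<open>M\<close> stands for the commutative
  monomial whose factors are the members of \<open>M\<close>.  The symmetric algebra of \<open>V\<close> is its quotient
  by the ideal that makes the inclusion of \<open>V\<close> linear.  See \<open>symalg_universal\<close> for the universal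
  property.
\<close>

inductive sym_ideal :: "('v::real_vector multiset \<Rightarrow>\<^sub>0 real) \<Rightarrow> bool" where
  sym_ideal_add: "sym_ideal (Poly_Mapping.single {#u + v#} 1
     - Poly_Mapping.single {#u#} 1 - Poly_Mapping.single {#v#} 1)"
| sym_ideal_scale: "sym_ideal (Poly_Mapping.single {#c *\<^sub>R v#} 1 - Poly_Mapping.single {#v#} c)"
| sym_ideal_plus: "sym_ideal p \<Longrightarrow> sym_ideal q \<Longrightarrow> sym_ideal (p + q)"
| sym_ideal_mult: "sym_ideal p \<Longrightarrow> sym_ideal (q * p)"

definition sym_equiv ::
  "('v::real_vector multiset \<Rightarrow>\<^sub>0 real) \<Rightarrow> ('v multiset \<Rightarrow>\<^sub>0 real) \<Rightarrow> bool" where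
  "sym_equiv p q \<longleftrightarrow> sym_ideal (p - q)"

lemma sym_ideal_0 [simp]: "sym_ideal 0"
  using sym_ideal_mult[OF sym_ideal_add, of 0] by simp

lemma sym_ideal_uminus: "sym_ideal p \<Longrightarrow> sym_ideal (- p)"
  using sym_ideal_mult[of p "- 1"] by simp

lemma sym_ideal_diff: "sym_ideal p \<Longrightarrow> sym_ideal q \<Longrightarrow> sym_ideal (p - q)"
  using sym_ideal_plus[of p "- q"] sym_ideal_uminus by auto

lemma equivp_sym_equiv:
  "equivp (sym_equiv :: ('v::real_vector multiset \<Rightarrow>\<^sub>0 real) \<Rightarrow> _)"
  (is "equivp ?E")
proof (rule equivpI)
  show "reflp ?E" by (simp add: reflp_def sym_equiv_def)
  show "symp ?E"
    unfolding symp_def sym_equiv_def by (metis minus_diff_eq sym_ideal_uminus)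
  show "transp ?E"
  proof (rule transpI)
    fix p q r :: "'v multiset \<Rightarrow>\<^sub>0 real"
    assume "sym_equiv p q" "sym_equiv q r"
    then have "sym_ideal ((p - q) + (q - r))" unfolding sym_equiv_def by (rule sym_ideal_plus)
    then show "sym_equiv p r" by (simp add: sym_equiv_def)
  qed
qed

lemma single_mult_lookup:
  fixes x :: "'v multiset \<Rightarrow>\<^sub>0 real"
  shows "Poly_Mapping.lookup (Poly_Mapping.single M c * x) N =
    (c * Poly_Mapping.lookup x (N - M) when M \<subseteq># N)"
proof -
  have "Poly_Mapping.lookup (Poly_Mapping.single M c * x) N
      = (\<Sum>l. (c when M = l) * (\<Sum>q. Poly_Mapping.lookup x q when N = l + q))"
    by (simp add: lookup_mult lookup_single)
  also have "\<dots> = (\<Sum>l. (c * (\<Sum>q. Poly_Mapping.lookup x q when N = M + q)) when l = M)"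
    by (rule Sum_any.cong) (auto simp: when_def)
  also have "\<dots> = c * (\<Sum>q. Poly_Mapping.lookup x q when N = M + q)"
    by simp
  also have "(\<Sum>q. Poly_Mapping.lookup x q when N = M + q)
      = (\<Sum>q. (Poly_Mapping.lookup x (N - M) when M \<subseteq># N) when q = N - M)"
    by (rule Sum_any.cong) (auto simp: when_def)
  also have "\<dots> = (Poly_Mapping.lookup x (N - M) when M \<subseteq># N)" by simp
  finally show ?thesis by (auto simp: when_def)
qed

lemma single_induct [case_names zero single plus]:
  fixes p :: "'a \<Rightarrow>\<^sub>0 real"
  assumes z: "P 0" and s: "\<And>M c. P (Poly_Mapping.single M c)"
    and a: "\<And>p q. P p \<Longrightarrow> P q \<Longrightarrow> P (p + q)"
  shows "P p"
proof (induction "card (Poly_Mapping.keys p)" arbitrary: p)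
  case 0
  then have "Poly_Mapping.keys p = {}" by simp
  then show ?case using z by simp
next
  case (Suc n)
  then obtain M where M: "M \<in> Poly_Mapping.keys p" by fastforce
  define q where "q = p - Poly_Mapping.single M (Poly_Mapping.lookup p M)"
  have "Poly_Mapping.keys q = Poly_Mapping.keys p - {M}"
    by (auto simp: q_def in_keys_iff lookup_minus lookup_single when_def split: if_splits)
  then have "P q" using Suc M by simp
  moreover have "p = q + Poly_Mapping.single M (Poly_Mapping.lookup p M)" by (simp add: q_def)
  ultimately show ?case using a s by metis
qed

quotient_type (overloaded) 'v symalg = "'v::real_vector multiset \<Rightarrow>\<^sub>0 real" / sym_equiv
  by (rule equivp_sym_equiv)

lift_definition homog_restrict :: "nat \<Rightarrow> ('v multiset \<Rightarrow>\<^sub>0 real) \<Rightarrow> ('v multiset \<Rightarrow>\<^sub>0 real)"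
  is "\<lambda>k p M. p M when size M = k"
  by (erule rev_finite_subset) auto

lemma lookup_homog_restrict:
  "Poly_Mapping.lookup (homog_restrict k p) M =
  (Poly_Mapping.lookup p M when size M = k)"
  by transfer rule

lemma homog_restrict_plus: "homog_restrict k (p + q) = homog_restrict k p + homog_restrict k q"
  by (rule poly_mapping_eqI) (simp add: lookup_homog_restrict lookup_add when_def)

lemma homog_restrict_diff: "homog_restrict k (p - q) = homog_restrict k p - homog_restrict k q"
  by (rule poly_mapping_eqI) (simp add: lookup_homog_restrict lookup_minus when_def)

lemma homog_restrict_0 [simp]: "homog_restrict k 0 = 0"
  by (rule poly_mapping_eqI) (simp add: lookup_homog_restrict)

lemma homog_restrict_single:
  "homog_restrict k (Poly_Mapping.single M c) = (if size M = k then Poly_Mapping.single M c else 0)"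
  by (rule poly_mapping_eqI) (auto simp: lookup_homog_restrict lookup_single when_def)

lemma homog_restrict_single_mult:
  "homog_restrict k (Poly_Mapping.single M c * x) =
     (if size M \<le> k then Poly_Mapping.single M c * homog_restrict (k - size M) x else 0)"
  by (rule poly_mapping_eqI)
    (auto simp: lookup_homog_restrict single_mult_lookup when_def size_Diff_submset
      dest: size_mset_mono)

lemma sym_ideal_homog_restrict: "sym_ideal p \<Longrightarrow> sym_ideal (homog_restrict k p)"
proof (induction arbitrary: k rule: sym_ideal.induct)
  case (sym_ideal_add u v)
  show ?case
    using sym_ideal.sym_ideal_add[of u v] by (simp add: homog_restrict_diff homog_restrict_single)
next
  case (sym_ideal_scale c v)
  show ?case
    using sym_ideal.sym_ideal_scale[of c v] by (simp add: homog_restrict_diff homog_restrict_single)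
next
  case (sym_ideal_plus p q)
  then show ?case by (simp add: homog_restrict_plus sym_ideal.sym_ideal_plus)
next
  case (sym_ideal_mult p q)
  show ?case
  proof (induction q rule: single_induct)
    case (single M c)
    then show ?case
      by (simp add: homog_restrict_single_mult sym_ideal.sym_ideal_mult sym_ideal_mult.IH)
  qed (simp_all add: homog_restrict_plus distrib_right sym_ideal.sym_ideal_plus)
qed

lemma sym_ideal_const_coeff: "sym_ideal p \<Longrightarrow> Poly_Mapping.lookup p {#} = 0"
proof (induction rule: sym_ideal.induct)
  case (sym_ideal_mult p q)
  show ?case
  proof (induction q rule: single_induct)
    case (single M c)
    then show ?case using sym_ideal_mult.IH by (simp add: single_mult_lookup when_def)
  qed (simp_all add: lookup_add distrib_right)
qed (simp_all add: lookup_minus lookup_add lookup_single when_def)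

instantiation symalg :: (real_vector) "{comm_ring_1, real_algebra_1}"
begin

lift_definition zero_symalg :: "'a symalg" is 0 .

lift_definition one_symalg :: "'a symalg" is 1 .

lift_definition plus_symalg :: "'a symalg \<Rightarrow> 'a symalg \<Rightarrow> 'a symalg" is "(+)"
  unfolding sym_equiv_def add_diff_add by (rule sym_ideal_plus)

lift_definition minus_symalg :: "'a symalg \<Rightarrow> 'a symalg \<Rightarrow> 'a symalg" is "(-)"
proof -
  fix p p' q q' :: "'a multiset \<Rightarrow>\<^sub>0 real"
  assume "sym_equiv p p'" "sym_equiv q q'"
  then have "sym_ideal ((p - p') - (q - q'))" unfolding sym_equiv_def by (rule sym_ideal_diff)
  moreover have "(p - p') - (q - q') = (p - q) - (p' - q')" by simp
  ultimately show "sym_equiv (p - q) (p' - q')" unfolding sym_equiv_def by metis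
qed

lift_definition uminus_symalg :: "'a symalg \<Rightarrow> 'a symalg" is uminus
proof -
  fix p p' :: "'a multiset \<Rightarrow>\<^sub>0 real"
  assume "sym_equiv p p'"
  then have "sym_ideal (- (p - p'))" unfolding sym_equiv_def by (rule sym_ideal_uminus)
  then show "sym_equiv (- p) (- p')" by (simp add: sym_equiv_def)
qed

lift_definition times_symalg :: "'a symalg \<Rightarrow> 'a symalg \<Rightarrow> 'a symalg" is "(*)"
proof -
  fix p p' q q' :: "'a multiset \<Rightarrow>\<^sub>0 real"
  assume "sym_equiv p p'" "sym_equiv q q'"
  then have "sym_ideal (q * (p - p') + p' * (q - q'))"
    unfolding sym_equiv_def by (intro sym_ideal_plus sym_ideal_mult)
  moreover have "q * (p - p') + p' * (q - q') = p * q - p' * q'" by (simp add: algebra_simps)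
  ultimately show "sym_equiv (p * q) (p' * q')" unfolding sym_equiv_def by metis
qed

lift_definition scaleR_symalg :: "real \<Rightarrow> 'a symalg \<Rightarrow> 'a symalg"
  is "\<lambda>c p. Poly_Mapping.single {#} c * p"
  unfolding sym_equiv_def right_diff_distrib[symmetric] by (rule sym_ideal_mult)

instance
proof
  fix a b c :: "'a symalg" and r s :: real
  show "a + b + c = a + (b + c)" by transfer (simp add: sym_equiv_def algebra_simps)
  show "a + b = b + a" by transfer (simp add: sym_equiv_def algebra_simps)
  show "0 + a = a" by transfer (simp add: sym_equiv_def)
  show "- a + a = 0" by transfer (simp add: sym_equiv_def)
  show "a - b = a + - b" by transfer (simp add: sym_equiv_def)
  show "a * b * c = a * (b * c)" by transfer (simp add: sym_equiv_def algebra_simps)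
  show "a * b = b * a" by transfer (simp add: sym_equiv_def algebra_simps)
  show "1 * a = a" by transfer (simp add: sym_equiv_def)
  show "(a + b) * c = a * c + b * c" by transfer (simp add: sym_equiv_def algebra_simps)
  show "a * (b + c) = a * b + a * c" by transfer (simp add: sym_equiv_def algebra_simps)
  show "a * 1 = a" by transfer (simp add: sym_equiv_def)
  show "(0::'a symalg) \<noteq> 1"
  proof (transfer, rule notI)
    assume "sym_equiv (0 :: 'a multiset \<Rightarrow>\<^sub>0 real) 1"
    then have "Poly_Mapping.lookup (0 - 1 :: 'a multiset \<Rightarrow>\<^sub>0 real) {#} = 0"
      unfolding sym_equiv_def by (rule sym_ideal_const_coeff)
    then show False by (simp add: lookup_one flip: zero_multiset_def)
  qed
  show "r *\<^sub>R (a + b) = r *\<^sub>R a + r *\<^sub>R b"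
    by transfer (simp add: sym_equiv_def algebra_simps)
  show "(r + s) *\<^sub>R a = r *\<^sub>R a + s *\<^sub>R a"
    by transfer (simp add: sym_equiv_def single_add algebra_simps)
  show "r *\<^sub>R s *\<^sub>R a = (r * s) *\<^sub>R a"
    by transfer (simp add: sym_equiv_def mult_single flip: mult.assoc)
  show "1 *\<^sub>R a = a"
    by transfer (simp add: sym_equiv_def flip: zero_multiset_def)
  show "r *\<^sub>R a * b = r *\<^sub>R (a * b)"
    by transfer (simp add: sym_equiv_def algebra_simps)
  show "a * r *\<^sub>R b = r *\<^sub>R (a * b)"
    by transfer (simp add: sym_equiv_def algebra_simps)
qed

end

lift_definition sym_of :: "'v::real_vector \<Rightarrow> 'v symalg"
  is "\<lambda>v. Poly_Mapping.single {#v#} 1" .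

text \<open>
  \<open>sym_part k f\<close> is the component of \<open>f\<close> in degree \<open>k\<close>; it is well defined because
  \<open>sym_ideal\<close> is homogeneous.
\<close>

lift_definition sym_part :: "nat \<Rightarrow> 'v::real_vector symalg \<Rightarrow> 'v symalg" is homog_restrict
  unfolding sym_equiv_def homog_restrict_diff[symmetric] by (rule sym_ideal_homog_restrict)

lemma sym_of_linear: "linear sym_of"
proof (rule linearI)
  fix u v :: 'a and c :: real
  show "sym_of (u + v) = sym_of u + sym_of v"
    by transfer (use sym_ideal_add in \<open>simp add: sym_equiv_def diff_diff_add\<close>)
  show "sym_of (c *\<^sub>R v) = c *\<^sub>R sym_of v"
    by transfer (use sym_ideal_scale in \<open>simp add: sym_equiv_def mult_single\<close>)
qed

lemma abs_symalg_single:
  "abs_symalg (Poly_Mapping.single M c) = c *\<^sub>R prod_mset (image_mset sym_of M)"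
proof (induction M)
  case empty
  have "abs_symalg (Poly_Mapping.single {#} c) = c *\<^sub>R 1"
    by transfer (simp add: sym_equiv_def)
  then show ?case by simp
next
  case (add v M)
  have "abs_symalg (Poly_Mapping.single (add_mset v M) c)
      = sym_of v * abs_symalg (Poly_Mapping.single M c)"
    by transfer (simp add: sym_equiv_def mult_single)
  then show ?case using add by simp
qed

lemma symalg_induct [case_names monomial plus]:
  fixes f :: "'v::real_vector symalg"
  assumes s: "\<And>M c. P (c *\<^sub>R prod_mset (image_mset sym_of M))"
    and a: "\<And>f g. P f \<Longrightarrow> P g \<Longrightarrow> P (f + g)"
  shows "P f"
proof -
  have "P (abs_symalg p)" for p :: "'v multiset \<Rightarrow>\<^sub>0 real"
  proof (induction p rule: single_induct)
    case zero
    then show ?case using s[of 0] by (simp add: zero_symalg.abs_eq)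
  next
    case (single M c)
    then show ?case using s by (simp add: abs_symalg_single)
  next
    case (plus p q)
    then show ?case using a by (simp flip: plus_symalg.abs_eq)
  qed
  then show ?thesis by (metis Quotient_abs_rep[OF Quotient_symalg])
qed

definition free_extend ::
  "('v \<Rightarrow> 'b::{comm_ring_1, real_algebra_1}) \<Rightarrow> ('v multiset \<Rightarrow>\<^sub>0 real) \<Rightarrow> 'b" where
  "free_extend h p =
     (\<Sum>M\<in>Poly_Mapping.keys p. Poly_Mapping.lookup p M *\<^sub>R prod_mset (image_mset h M))"

lemma free_extend_superset:
  assumes "finite A" "Poly_Mapping.keys p \<subseteq> A"
  shows "free_extend h p = (\<Sum>M\<in>A. Poly_Mapping.lookup p M *\<^sub>R prod_mset (image_mset h M))"
  unfolding free_extend_def using assms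
  by (intro sum.mono_neutral_left) (auto simp: in_keys_iff)

lemma free_extend_single:
  "free_extend h (Poly_Mapping.single M c) = c *\<^sub>R prod_mset (image_mset h M)"
  by (subst free_extend_superset[of "{M}"]) (auto simp: in_keys_iff lookup_single when_def)

lemma free_extend_0 [simp]: "free_extend h 0 = 0"
  by (simp add: free_extend_def)

lemma free_extend_plus: "free_extend h (p + q) = free_extend h p + free_extend h q"
proof -
  let ?A = "Poly_Mapping.keys p \<union> Poly_Mapping.keys q"
  have "Poly_Mapping.keys (p + q) \<subseteq> ?A" by (rule keys_add)
  then show ?thesis
    by (simp add: free_extend_superset[of ?A] lookup_add scaleR_left_distrib sum.distrib)
qed

lemma free_extend_diff: "free_extend h (p - q) = free_extend h p - free_extend h q"
  by (metis add_diff_cancel_right' diff_add_cancel free_extend_plus)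

lemma free_extend_mult: "free_extend h (p * q) = free_extend h p * free_extend h q"
proof (induction p rule: single_induct)
  case (single M c)
  show ?case
  proof (induction q rule: single_induct)
    case (single N d)
    then show ?case by (simp add: mult_single free_extend_single)
  qed (simp_all add: free_extend_plus distrib_left)
qed (simp_all add: free_extend_plus distrib_right)

lemma free_extend_sym_ideal:
  assumes "linear h"
  shows "sym_ideal p \<Longrightarrow> free_extend h p = 0"
  by (induction rule: sym_ideal.induct)
    (simp_all add: free_extend_plus free_extend_diff free_extend_mult free_extend_single
      linear_add[OF assms] linear_scale[OF assms])

theorem symalg_universal:
  fixes h :: "'v::real_vector \<Rightarrow> 'b::{comm_ring_1, real_algebra_1}"
  assumes "linear h"
  shows "\<exists>!H :: 'v symalg \<Rightarrow> 'b.
    linear H \<and> H 1 = 1 \<and> (\<forall>f g. H (f * g) = H f * H g) \<and> (\<forall>v. H (sym_of v) = h v)"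
proof (rule ex_ex1I)
  define H where "H f = free_extend h (rep_symalg f)" for f :: "'v symalg"
  have abs: "H (abs_symalg p) = free_extend h p" for p
  proof -
    have "sym_equiv (rep_symalg (abs_symalg p)) p"
      by (rule Quotient_rep_abs[OF Quotient_symalg]) (simp add: sym_equiv_def)
    then show ?thesis
      unfolding H_def sym_equiv_def
      using free_extend_sym_ideal[OF assms] by (fastforce simp: free_extend_diff)
  qed
  have ind: "\<exists>p. f = abs_symalg p" for f :: "'v symalg"
    by (metis Quotient_abs_rep[OF Quotient_symalg])
  have "H (f + g) = H f + H g" for f g
    using ind[of f] ind[of g] by (auto simp: plus_symalg.abs_eq abs free_extend_plus)
  moreover have "H (c *\<^sub>R f) = c *\<^sub>R H f" for c f
    using ind[of f]
    by (auto simp: scaleR_symalg.abs_eq abs free_extend_mult free_extend_single)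
  moreover have "H (f * g) = H f * H g" for f g
    using ind[of f] ind[of g] by (auto simp: times_symalg.abs_eq abs free_extend_mult)
  moreover have "H 1 = 1"
    by (simp add: one_symalg.abs_eq abs free_extend_single flip: single_one)
  moreover have "H (sym_of v) = h v" for v
    by (simp add: sym_of.abs_eq abs free_extend_single)
  ultimately show "\<exists>H. linear H \<and> H 1 = 1 \<and> (\<forall>f g. H (f * g) = H f * H g) \<and> 
      (\<forall>v. H (sym_of v) = h v)"
    by (intro exI[of _ H]) (auto intro: linearI)
next
  fix H G :: "'v symalg \<Rightarrow> 'b"
  assume H: "linear H \<and> H 1 = 1 \<and> (\<forall>f g. H (f * g) = H f * H g) \<and> (\<forall>v. H (sym_of v) = h v)"
    and G: "linear G \<and> G 1 = 1 \<and> (\<forall>f g. G (f * g) = G f * G g) \<and> (\<forall>v. G (sym_of v) = h v)"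
  have "H f = G f" for f
  proof (induction f rule: symalg_induct)
    case (monomial M c)
    have "H (prod_mset (image_mset sym_of M)) = G (prod_mset (image_mset sym_of M))"
      using H G by (induction M) auto
    then show ?case using H G by (simp add: linear_scale)
  next
    case (plus f g)
    then show ?case using H G by (simp add: linear_add)
  qed
  then show "H = G" ..
qed

lemma inj_sym_of: "inj sym_of"
proof (rule linear_injective_0[THEN iffD2, OF sym_of_linear], intro allI impI)
  fix v :: 'a
  assume v: "sym_of v = 0"
  show "v = 0"
  proof (rule ccontr)
    assume "v \<noteq> 0"
    then have "independent {v}" by simp
    from linear_independent_extend[OF this, of "\<lambda>_. 1 :: real"]
    obtain h :: "'a \<Rightarrow> real" where h: "linear h" "h v = 1" by auto
    from symalg_universal[OF h(1)]
    obtain H :: "'a symalg \<Rightarrow> real" where "linear H" "H (sym_of v) = h v" by blast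
    then show False using v h(2) by (simp add: linear_0)
  qed
qed

text \<open>The grading: \<open>symalg_deg k\<close> is spanned by the products of \<open>k\<close> vectors.\<close>

definition symalg_deg :: "nat \<Rightarrow> 'v::real_vector symalg set" where
  "symalg_deg k = span {\<Prod>j=1..k. sym_of (g j) | g. True}"

lemma linear_sym_part: "linear (sym_part k)"
proof (rule linearI)
  fix f g :: "'a symalg" and c :: real
  show "sym_part k (f + g) = sym_part k f + sym_part k g"
    by transfer (simp add: sym_equiv_def homog_restrict_plus)
  show "sym_part k (c *\<^sub>R f) = c *\<^sub>R sym_part k f"
    by transfer (simp add: sym_equiv_def homog_restrict_single_mult)
qed

lemma sym_part_monomial:
  "sym_part k (prod_mset (image_mset sym_of M)) =
     (if size M = k then prod_mset (image_mset sym_of M) else 0)"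
proof -
  have "prod_mset (image_mset sym_of M) = abs_symalg (Poly_Mapping.single M 1)"
    by (simp add: abs_symalg_single)
  then show ?thesis
    by (simp add: sym_part.abs_eq homog_restrict_single zero_symalg.abs_eq)
qed

lemma monomial_in_symalg_deg: "prod_mset (image_mset sym_of M) \<in> symalg_deg (size M)"
proof -
  obtain xs where M: "M = mset xs" by (metis ex_mset)
  have "prod_mset (image_mset sym_of M) = (\<Prod>j=1..size M. sym_of (xs ! (j - 1)))"
  proof -
    have "prod_mset (image_mset sym_of M) = prod_list (map sym_of xs)"
      by (simp add: M flip: prod_mset_prod_list)
    also have "\<dots> = (\<Prod>j=0..<length xs. sym_of (xs ! j))"
      by (simp add: prod.list_conv_set_nth)
    also have "\<dots> = (\<Prod>j=1..length xs. sym_of (xs ! (j - 1)))"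
      by (rule prod.reindex_bij_witness[of _ "\<lambda>j. j - 1" Suc]) auto
    finally show ?thesis by (simp add: M)
  qed
  then show ?thesis
    unfolding symalg_deg_def by (intro span_base) (auto intro: exI[of _ "\<lambda>j. xs ! (j - 1)"])
qed

lemma sym_part_in_symalg_deg: "sym_part k f \<in> symalg_deg k"
proof (induction f rule: symalg_induct)
  case (monomial M c)
  show ?case
    using monomial_in_symalg_deg[of M]
    by (auto simp: linear_scale[OF linear_sym_part] sym_part_monomial symalg_deg_def span_scale span_0)
next
  case (plus f g)
  then show ?case
    by (simp add: linear_add[OF linear_sym_part] symalg_deg_def span_add)
qed

lemma sym_part_symalg_deg:
  assumes "f \<in> symalg_deg l"
  shows "sym_part k f = (if k = l then f else 0)"
  using assms unfolding symalg_deg_def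
proof (induction rule: span_induct_alt)
  case base
  show ?case by (simp add: linear_0[OF linear_sym_part])
next
  case (step c x y)
  then obtain g where x: "x = (\<Prod>j=1..l. sym_of (g j))" by auto
  have "x = prod_mset (image_mset sym_of (image_mset g (mset_set {1..l})))"
    by (simp add: x prod_unfold_prod_mset multiset.map_comp comp_def)
  then have "sym_part k x = (if k = l then x else 0)"
    by (auto simp only: sym_part_monomial) auto
  then show ?case
    using step.IH by (simp add: linear_add[OF linear_sym_part] linear_scale[OF linear_sym_part])
qed

lemma sym_part_decomposition:
  "finite {k. sym_part k f \<noteq> 0}" "f = (\<Sum>k | sym_part k f \<noteq> 0. sym_part k f)"
proof -
  have "\<exists>n. (\<forall>k\<ge>n. sym_part k f = 0) \<and> f = (\<Sum>k<n. sym_part k f)"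
  proof (induction f rule: symalg_induct)
    case (monomial M c)
    show ?case
      by (intro exI[of _ "Suc (size M)"])
        (auto simp: linear_scale[OF linear_sym_part] sym_part_monomial)
  next
    case (plus f g)
    then obtain n m where
      n: "\<forall>k\<ge>n. sym_part k f = 0" "f = (\<Sum>k<n. sym_part k f)" and
      m: "\<forall>k\<ge>m. sym_part k g = 0" "g = (\<Sum>k<m. sym_part k g)" by blast
    have "(\<Sum>k<n. sym_part k f) = (\<Sum>k<max n m. sym_part k f)"
      using n(1) by (intro sum.mono_neutral_left) auto
    moreover have "(\<Sum>k<m. sym_part k g) = (\<Sum>k<max n m. sym_part k g)"
      using m(1) by (intro sum.mono_neutral_left) auto
    ultimately show ?case using n m
      by (intro exI[of _ "max n m"]) (simp add: linear_add[OF linear_sym_part] sum.distrib)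
  qed
  then obtain n where n: "\<forall>k\<ge>n. sym_part k f = 0" "f = (\<Sum>k<n. sym_part k f)" by blast
  then have sub: "{k. sym_part k f \<noteq> 0} \<subseteq> {..<n}" by (auto simp: not_le[symmetric])
  then show "finite {k. sym_part k f \<noteq> 0}" by (rule finite_subset) simp
  have "(\<Sum>k | sym_part k f \<noteq> 0. sym_part k f) = (\<Sum>k<n. sym_part k f)"
    using sub by (intro sum.mono_neutral_left) auto
  then show "f = (\<Sum>k | sym_part k f \<noteq> 0. sym_part k f)" using n(2) by simp
qed

section \<open>Seminorms and the topologies they generate\<close>

definition seminorm :: "('a::real_vector \<Rightarrow> real) \<Rightarrow> bool" where
  "seminorm p \<longleftrightarrow> (\<forall>x. 0 \<le> p x) \<and> (\<forall>x y. p (x + y) \<le> p x + p y) \<and>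
     (\<forall>c x. p (c *\<^sub>R x) = \<bar>c\<bar> * p x)"

definition submultiplicative :: "('a::real_algebra_1 \<Rightarrow> real) \<Rightarrow> bool" where
  "submultiplicative p \<longleftrightarrow> (\<forall>x y. p (x * y) \<le> p x * p y)"

text \<open>
  The open balls of the members of \<open>P\<close> form a subbase.  \<open>UNIV\<close> is inserted because otherwise
  the topology generated by the empty family would have the empty set as carrier.
\<close>

definition seminorm_topology :: "('a::real_vector \<Rightarrow> real) set \<Rightarrow> 'a topology" where
  "seminorm_topology P =
     topology_generated_by (insert UNIV {{x. p (x - a) < e} | p a e. p \<in> P \<and> 0 < e})"

definition lmc_topology :: "'a::real_algebra_1 topology \<Rightarrow> bool" where
  "lmc_topology T \<longleftrightarrow>
     (\<exists>P. (\<forall>p\<in>P. seminorm p \<and> submultiplicative p) \<and> T = seminorm_topology P)"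

definition directed_family :: "('a \<Rightarrow> real) set \<Rightarrow> bool" where
  "directed_family S \<longleftrightarrow> S \<noteq> {} \<and>
     (\<forall>\<rho>1\<in>S. \<forall>\<rho>2\<in>S. \<exists>\<rho>\<in>S. \<exists>C>0. \<forall>v. max (\<rho>1 v) (\<rho>2 v) \<le> C * \<rho> v)"

section \<open>The projective extension\<close>

text \<open>
  In degree \<open>0\<close> the scalar \<open>c\<close> is identified with \<open>of_real c\<close>.  The values of \<open>proj_ext_deg \<rho> k\<close>
  are meaningful on \<open>symalg_deg k\<close> only.
\<close>

definition proj_ext_deg :: "('v::real_vector \<Rightarrow> real) \<Rightarrow> nat \<Rightarrow> 'v symalg \<Rightarrow> real" where
  "proj_ext_deg \<rho> k f =
     (if k = 0 then \<bar>THE c. f = of_real c\<bar>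
      else Inf {\<Sum>i=1..n. \<Prod>j=1..k. \<rho> (g i j) | (n::nat) (g :: nat \<Rightarrow> nat \<Rightarrow> 'v).
                  n \<ge> 1 \<and> f = (\<Sum>i=1..n. \<Prod>j=1..k. sym_of (g i j))})"

definition proj_ext :: "('v::real_vector \<Rightarrow> real) \<Rightarrow> 'v symalg \<Rightarrow> real" where
  "proj_ext \<rho> f = (\<Sum>k | sym_part k f \<noteq> 0. proj_ext_deg \<rho> k (sym_part k f))"

definition proj_ext_topology :: "('v::real_vector \<Rightarrow> real) set \<Rightarrow> 'v symalg topology" where
  "proj_ext_topology S =
     seminorm_topology {proj_ext (\<lambda>v. real i * \<rho> v) | i \<rho>. i \<ge> 1 \<and> \<rho> \<in> S}"

text \<open>The topology induced on \<open>V\<close>, which is identified with its image under \<open>sym_of\<close>.\<close>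

definition extends_topology :: "'v::real_vector symalg topology \<Rightarrow> 'v topology \<Rightarrow> bool" where
  "extends_topology T \<tau> \<longleftrightarrow> pullback_topology UNIV sym_of T = \<tau>"

end

theory Submission
  imports Defs
begin

text \<open>
  The projective extension of \<open>\<rho>\<close> is the largest seminorm on the symmetric algebra whose value on
  each monomial \<open>v\<^sub>1 \<cdots> v\<^sub>k\<close> is at most \<open>\<rho> v\<^sub>1 \<cdots> \<rho> v\<^sub>k\<close>; likewise
  a bound \<open>C (\<rho> v\<^sub>1 \<cdots> \<rho> v\<^sub>k)\<close> on monomials gives the bound \<open>C \<cdot> proj_ext \<rho>\<close>.
  Applied to multiplication by a fixed element this gives submultiplicativity; applied to
  a submultiplicative seminorm \<open>p\<close> with \<open>p \<le> \<sigma>\<close> on \<open>V\<close> it gives \<open>p \<le> p 1 \<cdot> proj_ext \<sigma>\<close>.  If \<open>p\<close>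
  is continuous on \<open>V\<close>, directedness provides such a \<open>\<sigma>\<close> of the form \<open>i\<rho>\<close>, so the topology
  of \<open>p\<close> is coarser than the projective one.
\<close>

section \<open>Seminorms\<close>

lemma seminorm_nonneg: "seminorm p \<Longrightarrow> 0 \<le> p x"
  and seminorm_triangle: "seminorm p \<Longrightarrow> p (x + y) \<le> p x + p y"
  and seminorm_scale: "seminorm p \<Longrightarrow> p (c *\<^sub>R x) = \<bar>c\<bar> * p x"
  by (auto simp: seminorm_def)

lemma seminorm_zero: "seminorm p \<Longrightarrow> p 0 = 0"
  using seminorm_scale[of p 0 0] by simp

lemma seminorm_sum: "seminorm p \<Longrightarrow> p (sum f A) \<le> (\<Sum>x\<in>A. p (f x))"
  by (induction A rule: infinite_finite_induct)
    (auto simp: seminorm_zero intro: order_trans[OF seminorm_triangle])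

lemma seminorm_real_mult:
  assumes "seminorm p" "0 \<le> r"
  shows "seminorm (\<lambda>x. r * p x)"
  using assms mult_left_mono[OF seminorm_triangle[OF assms(1)] assms(2)]
  by (auto simp: seminorm_def distrib_left)

lemma seminorm_compose_linear:
  assumes "seminorm p" "linear h"
  shows "seminorm (\<lambda>x. p (h x))"
  using assms by (auto simp: seminorm_def linear_add linear_scale)

text \<open>Rescale \<open>x\<close> into the \<open>q\<close>-ball. If \<open>q x\<close> is
  positive, a multiple with \<open>q\<close>-value \<open>e / 2\<close> gives the bound; if
  \<open>q x = 0\<close>, all multiples of \<open>x\<close> lie in the ball, which forces
  \<open>p x = 0\<close>.\<close>

lemma seminorm_dominated_of_ball:
  assumes p: "seminorm p" and q: "seminorm q" and e: "0 < e"
    and ball: "\<And>x. q x < e \<Longrightarrow> p x < 1"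
  shows "p x \<le> 2 / e * q x"
proof (cases "q x = 0")
  case True
  have "p x = 0"
  proof (rule ccontr)
    assume "p x \<noteq> 0"
    moreover have "p ((1 / p x) *\<^sub>R x) < 1"
      using True e by (intro ball) (simp add: seminorm_scale[OF q])
    ultimately show False
      using seminorm_nonneg[OF p, of x] by (simp add: seminorm_scale[OF p])
  qed
  then show ?thesis using True by simp
next
  case False
  then have pos: "0 < q x" using seminorm_nonneg[OF q, of x] by simp
  have "p ((e / (2 * q x)) *\<^sub>R x) < 1"
    using pos e by (intro ball) (simp add: seminorm_scale[OF q])
  then show ?thesis using pos e by (simp add: seminorm_scale[OF p] field_simps)
qed

section \<open>Topologies generated by seminorms\<close>

lemma topspace_seminorm_topology [simp]: "topspace (seminorm_topology P) = UNIV"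
  by (auto simp: seminorm_topology_def topology_generated_by_topspace)

lemma openin_seminorm_ball:
  "p \<in> P \<Longrightarrow> 0 < e \<Longrightarrow> openin (seminorm_topology P) {x. p (x - a) < e}"
  unfolding seminorm_topology_def by (rule topology_generated_by_Basis) blast

text \<open>A small \<open>q\<close>-ball around each point of the sublevel set stays inside it by
  the Lipschitz bound. In the uses, \<open>\<phi>\<close> measures the distance to a fixed centre in
  another seminorm.\<close>

lemma openin_sublevel_seminorm_topology:
  fixes \<phi> :: "'a::real_vector \<Rightarrow> real"
  assumes "q \<in> P" "seminorm q" "0 \<le> C" and lip: "\<And>x y. \<phi> y \<le> \<phi> x + C * q (y - x)"
  shows "openin (seminorm_topology P) {x. \<phi> x < e}"
proof (subst openin_subopen, intro ballI)
  fix x assume "x \<in> {x. \<phi> x < e}"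
  \<comment> \<open>The divisor \<open>C + 1\<close> stays positive also for
    \<open>C = 0\<close>.\<close>
  then have d: "0 < (e - \<phi> x) / (C + 1)" using assms(3) by simp
  have "\<phi> y < e" if "q (y - x) < (e - \<phi> x) / (C + 1)" for y
  proof -
    have "C * q (y - x) \<le> (C + 1) * q (y - x)"
      using seminorm_nonneg[OF assms(2)] by (intro mult_right_mono) auto
    also have "\<dots> < e - \<phi> x" using that assms(3) by (simp add: field_simps)
    finally show ?thesis using lip[of y x] by simp
  qed
  then show "\<exists>T. openin (seminorm_topology P) T \<and> x \<in> T \<and> T \<subseteq> {x. \<phi> x < e}"
    using d openin_seminorm_ball[OF assms(1) d] seminorm_zero[OF assms(2)]
    by (intro exI[of _ "{y. q (y - x) < (e - \<phi> x) / (C + 1)}"]) auto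
qed

text \<open>It suffices to check preimages of the subbase. With \<open>f = id\<close> this compares
  two topologies on one space.\<close>

lemma continuous_map_seminorm_topology:
  assumes "topspace T = UNIV"
    and "\<And>p a e. p \<in> P \<Longrightarrow> 0 < e \<Longrightarrow> openin T {x. p (f x - a) < e}"
  shows "continuous_map T (seminorm_topology P) f"
  unfolding seminorm_topology_def
proof (rule continuous_on_generated_topo)
  fix U assume "U \<in> insert UNIV {{x. p (x - a) < e} | p a e. p \<in> P \<and> 0 < e}"
  then show "openin T (f -` U \<inter> topspace T)"
    using assms openin_topspace[of T] by (auto simp: vimage_def)
qed auto

lemma seminorm_topology_coarser:
  assumes "\<And>p a e. p \<in> P \<Longrightarrow> 0 < e \<Longrightarrow> openin (seminorm_topology Q) {x. p (x - a) < e}"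
    and "openin (seminorm_topology P) U"
  shows "openin (seminorm_topology Q) U"
  using openin_continuous_map_preimage[OF continuous_map_seminorm_topology[where f = id] assms(2),
      of "seminorm_topology Q"] assms(1)
  by simp

text \<open>Open sets arise from finite intersections and unions of balls with arbitrary centres.
  The triangle inequality recentres a ball at \<open>x\<close>, and directedness merges two balls
  around \<open>x\<close> into one.\<close>

lemma directed_seminorm_topology_ball:
  assumes sem: "\<forall>\<rho>\<in>S. seminorm \<rho>" and dir: "directed_family S"
    and "openin (seminorm_topology S) U" "x \<in> U"
  shows "\<exists>\<rho>\<in>S. \<exists>e>0. {y. \<rho> (y - x) < e} \<subseteq> U"
proof -
  have "generate_topology_on (insert UNIV {{x. p (x - a) < e} | p a e. p \<in> S \<and> 0 < e}) U"
    using assms(3) by (simp add: seminorm_topology_def openin_topology_generated_by_iff)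
  then show ?thesis using assms(4)
  proof (induction arbitrary: x rule: generate_topology_on.induct)
    case (Int A B)
    from Int.IH(1)[of x] Int.prems obtain \<rho>1 e1 where
      1: "\<rho>1 \<in> S" "0 < e1" "{y. \<rho>1 (y - x) < e1} \<subseteq> A" by auto
    from Int.IH(2)[of x] Int.prems obtain \<rho>2 e2 where
      2: "\<rho>2 \<in> S" "0 < e2" "{y. \<rho>2 (y - x) < e2} \<subseteq> B" by auto
    obtain \<rho> C where \<rho>: "\<rho> \<in> S" "0 < C" "\<And>v. max (\<rho>1 v) (\<rho>2 v) \<le> C * \<rho> v"
      using dir 1(1) 2(1) unfolding directed_family_def by metis
    have "\<rho>1 (y - x) < e1 \<and> \<rho>2 (y - x) < e2" if "\<rho> (y - x) < min e1 e2 / C" for y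
    proof -
      have "C * \<rho> (y - x) < min e1 e2" using that \<rho>(2) by (simp add: field_simps)
      then show ?thesis using \<rho>(3)[of "y - x"] by linarith
    qed
    then show ?case
      using 1 2 \<rho> by (intro bexI[of _ \<rho>] exI[of _ "min e1 e2 / C"]) auto
  next
    case (UN K)
    then obtain k where "k \<in> K" "x \<in> k" by auto
    with UN.IH[OF this] show ?case by blast
  next
    case (Basis B)
    consider "B = UNIV" | p a e where "B = {x. p (x - a) < e}" "p \<in> S"
      using Basis.hyps by auto
    then show ?case
    proof cases
      case 1
      \<comment> \<open>Non-emptiness of \<open>S\<close> enters here: some \<open>\<rho>\<close>
        must supply a ball.\<close>
      then show ?thesis using dir by (auto simp: directed_family_def intro: exI[of _ 1])
    next
      case (2 p a e)
      have "p (y - a) < e" if "p (y - x) < e - p (x - a)" for y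
        using seminorm_triangle[of p "y - x" "x - a"] that sem 2 by simp
      then show ?thesis using 2 Basis.prems
        by (intro bexI[of _ p] exI[of _ "e - p (x - a)"]) auto
    qed
  qed simp
qed

section \<open>The projective extension\<close>

lemma prod_nonneg_seminorm: "seminorm \<rho> \<Longrightarrow> 0 \<le> (\<Prod>j\<in>A. \<rho> (g j))"
  by (intro prod_nonneg ballI seminorm_nonneg)

text \<open>The sums are nonnegative, so the set of sums is bounded below and its \<open>Inf\<close>
  is a genuine lower bound.\<close>

lemma proj_ext_deg_le:
  fixes \<rho> :: "'v::real_vector \<Rightarrow> real" and g :: "nat \<Rightarrow> nat \<Rightarrow> 'v"
  assumes "seminorm \<rho>" "1 \<le> k" "1 \<le> n"
    and "f = (\<Sum>i=1..n. \<Prod>j=1..k. sym_of (g i j))"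
  shows "proj_ext_deg \<rho> k f \<le> (\<Sum>i=1..n. \<Prod>j=1..k. \<rho> (g i j))"
proof -
  let ?R = "{\<Sum>i=1..n. \<Prod>j=1..k. \<rho> (g i j) | (n::nat) (g :: nat \<Rightarrow> nat \<Rightarrow> 'v).
    n \<ge> 1 \<and> f = (\<Sum>i=1..n. \<Prod>j=1..k. sym_of (g i j))}"
  have "bdd_below ?R"
    using prod_nonneg_seminorm[OF assms(1)] by (intro bdd_belowI[of _ 0]) (auto intro!: sum_nonneg)
  moreover have "(\<Sum>i=1..n. \<Prod>j=1..k. \<rho> (g i j)) \<in> ?R" using assms(3,4) by blast
  ultimately show ?thesis using assms(2) by (simp add: proj_ext_deg_def cInf_lower)
qed

text \<open>Serves to concatenate two representations of lengths \<open>n\<close> and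
  \<open>m\<close>.\<close>

lemma sum_shift_append:
  fixes a b :: "nat \<Rightarrow> 'a::comm_monoid_add"
  shows "(\<Sum>i=1..n + m. if i \<le> n then a i else b (i - n)) = (\<Sum>i=1..n. a i) + (\<Sum>i=1..m. b i)"
proof -
  have "(\<Sum>i=1..n + m. if i \<le> n then a i else b (i - n)) =
      (\<Sum>i=1..n. if i \<le> n then a i else b (i - n)) +
      (\<Sum>i=n + 1..n + m. if i \<le> n then a i else b (i - n))"
    by (rule sum.ub_add_nat) simp
  moreover have "(\<Sum>i=n + 1..n + m. if i \<le> n then a i else b (i - n)) = (\<Sum>i=1..m. b i)"
    by (rule sum.reindex_bij_witness[of _ "\<lambda>i. i + n" "\<lambda>i. i - n"]) auto
  ultimately show ?thesis by simp
qed

text \<open>This makes the infimum range over a non-empty set. Coefficients of a linear combination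
  are absorbed into the first factor of each product, which exists because \<open>k\<close> is
  positive.\<close>

lemma symalg_deg_repr:
  fixes f :: "'v::real_vector symalg"
  assumes "1 \<le> k" "f \<in> symalg_deg k"
  shows "\<exists>n\<ge>1::nat. \<exists>g :: nat \<Rightarrow> nat \<Rightarrow> 'v. f = (\<Sum>i=1..n. \<Prod>j=1..k. sym_of (g i j))"
  using assms(2) unfolding symalg_deg_def
proof (induction rule: span_induct_alt)
  case base
  \<comment> \<open>The empty sum is excluded by \<open>n \<ge> 1\<close>, so zero is written as one
    product of zero vectors.\<close>
  have "0 = (\<Prod>j=1..k. sym_of (0 :: 'v))"
    using assms(1) by (simp add: linear_0[OF sym_of_linear] power_0_left)
  then show ?case by (intro exI[of _ 1]) (auto intro!: exI[of _ "\<lambda>_ _. 0"])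
next
  case (step c x y)
  from step obtain g and n :: nat and h :: "nat \<Rightarrow> nat \<Rightarrow> 'v" where x: "x = (\<Prod>j=1..k. sym_of (g j))" and
    n: "n \<ge> 1" and y: "y = (\<Sum>i=1..n. \<Prod>j=1..k. sym_of (h i j))" by auto
  define g' where "g' j = (if j = 1 then c *\<^sub>R g 1 else g j)" for j
  have "(\<Prod>j=1..k. sym_of (g' j)) = c *\<^sub>R x"
    unfolding x
    by (simp add: prod.atLeast_Suc_atMost[OF assms(1), simplified] g'_def linear_scale[OF sym_of_linear])
  then have "c *\<^sub>R x + y =
      (\<Sum>i=1..n + 1. \<Prod>j=1..k. sym_of (if i \<le> n then h i j else g' j))"
    unfolding y by (simp add: add.commute)
  then show ?case using n
    by (intro exI[of _ "n + 1"] conjI exI[of _ "\<lambda>i j. if i \<le> n then h i j else g' j"]) auto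
qed

lemma proj_ext_deg_approx:
  fixes \<rho> :: "'v::real_vector \<Rightarrow> real"
  assumes "1 \<le> k" "f \<in> symalg_deg k" "proj_ext_deg \<rho> k f < r"
  obtains n :: nat and g :: "nat \<Rightarrow> nat \<Rightarrow> 'v" where "1 \<le> n" "f = (\<Sum>i=1..n. \<Prod>j=1..k. sym_of (g i j))"
    "(\<Sum>i=1..n. \<Prod>j=1..k. \<rho> (g i j)) < r"
proof -
  let ?R = "{\<Sum>i=1..n. \<Prod>j=1..k. \<rho> (g i j) | (n::nat) (g :: nat \<Rightarrow> nat \<Rightarrow> 'v).
    n \<ge> 1 \<and> f = (\<Sum>i=1..n. \<Prod>j=1..k. sym_of (g i j))}"
  have "?R \<noteq> {}" using symalg_deg_repr[OF assms(1,2)] by blast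
  moreover have "Inf ?R < r" using assms(1,3) by (simp add: proj_ext_deg_def)
  ultimately obtain x where "x \<in> ?R" "x < r" using cInf_lessD[of ?R r] by blast
  then show thesis using that by blast
qed

lemma proj_ext_deg_0: "proj_ext_deg \<rho> 0 (of_real c) = \<bar>c\<bar>"
  by (simp add: proj_ext_deg_def)

text \<open>The product over the empty range is \<open>1\<close>, so degree 0 is the span of
  \<open>1\<close>.\<close>

lemma symalg_deg_0: "f \<in> symalg_deg 0 \<Longrightarrow> \<exists>c. f = of_real c"
  by (auto simp: symalg_deg_def span_singleton of_real_def)

lemma proj_ext_deg_nonneg:
  fixes \<rho> :: "'v::real_vector \<Rightarrow> real"
  assumes "seminorm \<rho>" "f \<in> symalg_deg k"
  shows "0 \<le> proj_ext_deg \<rho> k f"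
proof (cases "k = 0")
  case False
  then have k: "1 \<le> k" by simp
  show ?thesis
  proof (rule ccontr)
    assume "\<not> ?thesis"
    then have "proj_ext_deg \<rho> k f < 0" by simp
    then obtain n and g :: "nat \<Rightarrow> nat \<Rightarrow> 'v" where
      "(\<Sum>i=1..n. \<Prod>j=1..k. \<rho> (g i j)) < 0"
      by (rule proj_ext_deg_approx[OF k assms(2)])
    moreover have "0 \<le> (\<Sum>i=1..n. \<Prod>j=1..k. \<rho> (g i j))"
      by (intro sum_nonneg prod_nonneg_seminorm assms(1))
    ultimately show False by simp
  qed
qed (simp add: proj_ext_deg_def)

text \<open>Concatenating representations that are optimal up to \<open>e / 2\<close> gives a
  representation of the sum with total error below \<open>e\<close>.\<close>

lemma proj_ext_deg_triangle:
  fixes \<rho> :: "'v::real_vector \<Rightarrow> real"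
  assumes "seminorm \<rho>" "f \<in> symalg_deg k" "f' \<in> symalg_deg k"
  shows "proj_ext_deg \<rho> k (f + f') \<le> proj_ext_deg \<rho> k f + proj_ext_deg \<rho> k f'"
proof (cases "k = 0")
  case True
  then obtain c c' where c: "f = of_real c" "f' = of_real c'"
    using symalg_deg_0[of f] symalg_deg_0[of f'] assms(2,3) by auto
  have "f + f' = of_real (c + c')" by (simp add: c)
  then show ?thesis unfolding True by (simp only: c proj_ext_deg_0 abs_triangle_ineq)
next
  case False
  then have k: "1 \<le> k" by simp
  show ?thesis
  proof (rule field_le_epsilon)
    fix e :: real assume "0 < e"
    then have e: "\<And>x. x < x + e / 2" by simp
    obtain n and g :: "nat \<Rightarrow> nat \<Rightarrow> 'v" where
      n: "1 \<le> n" "f = (\<Sum>i=1..n. \<Prod>j=1..k. sym_of (g i j))"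
        "(\<Sum>i=1..n. \<Prod>j=1..k. \<rho> (g i j)) < proj_ext_deg \<rho> k f + e / 2"
      by (rule proj_ext_deg_approx[OF k assms(2) e])
    obtain m and h :: "nat \<Rightarrow> nat \<Rightarrow> 'v" where
      m: "1 \<le> m" "f' = (\<Sum>i=1..m. \<Prod>j=1..k. sym_of (h i j))"
        "(\<Sum>i=1..m. \<Prod>j=1..k. \<rho> (h i j)) < proj_ext_deg \<rho> k f' + e / 2"
      by (rule proj_ext_deg_approx[OF k assms(3) e])
    define G where "G i = (if i \<le> n then g i else h (i - n))" for i
    \<comment> \<open>The codomain of \<open>\<phi>\<close> is left open because the identity is
      needed both for \<open>sym_of\<close> and for \<open>\<rho>\<close>.\<close>
    have G: "(\<Sum>i=1..n + m. \<Prod>j=1..k. \<phi> (G i j)) =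
        (\<Sum>i=1..n. \<Prod>j=1..k. \<phi> (g i j)) + (\<Sum>i=1..m. \<Prod>j=1..k. \<phi> (h i j))"
      for \<phi> :: "'v \<Rightarrow> 'c::comm_semiring_1"
      unfolding sum_shift_append[symmetric] G_def by (intro sum.cong) auto
    have "proj_ext_deg \<rho> k (f + f') \<le> (\<Sum>i=1..n + m. \<Prod>j=1..k. \<rho> (G i j))"
      using n m by (intro proj_ext_deg_le[OF assms(1) k]) (auto simp only: G)
    then show "proj_ext_deg \<rho> k (f + f') \<le> proj_ext_deg \<rho> k f + proj_ext_deg \<rho> k f' + e"
      using n(3) m(3) unfolding G by linarith
  qed
qed

text \<open>Multiply the first factor of every term of a near-optimal representation by
  \<open>c\<close>. The inequality is enough: equality for the whole extension follows by applying
  it to \<open>inverse c\<close>.\<close>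

lemma proj_ext_deg_scale_le:
  fixes \<rho> :: "'v::real_vector \<Rightarrow> real"
  assumes "seminorm \<rho>" "f \<in> symalg_deg k"
  shows "proj_ext_deg \<rho> k (c *\<^sub>R f) \<le> \<bar>c\<bar> * proj_ext_deg \<rho> k f"
proof (cases "k = 0")
  case True
  then obtain d where "f = of_real d" using symalg_deg_0[of f] assms(2) by auto
  then have "c *\<^sub>R f = of_real (c * d)" by (simp add: of_real_def)
  then show ?thesis using True \<open>f = of_real d\<close> by (simp only: proj_ext_deg_0 abs_mult)
next
  case False
  then have k: "1 \<le> k" by simp
  have "proj_ext_deg \<rho> k (c *\<^sub>R f) \<le> \<bar>c\<bar> * r" if less: "proj_ext_deg \<rho> k f < r" for r
  proof -
    obtain n and g :: "nat \<Rightarrow> nat \<Rightarrow> 'v" where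
      n: "1 \<le> n" "f = (\<Sum>i=1..n. \<Prod>j=1..k. sym_of (g i j))"
        "(\<Sum>i=1..n. \<Prod>j=1..k. \<rho> (g i j)) < r"
      by (rule proj_ext_deg_approx[OF k assms(2) less])
    define G where "G i j = (if j = 1 then c *\<^sub>R g i 1 else g i j)" for i j
    have "(\<Prod>j=1..k. sym_of (G i j)) = c *\<^sub>R (\<Prod>j=1..k. sym_of (g i j))" for i
      by (simp add: prod.atLeast_Suc_atMost[OF k, simplified] G_def linear_scale[OF sym_of_linear])
    moreover have "(\<Prod>j=1..k. \<rho> (G i j)) = \<bar>c\<bar> * (\<Prod>j=1..k. \<rho> (g i j))" for i
      by (simp add: prod.atLeast_Suc_atMost[OF k, simplified] G_def seminorm_scale[OF assms(1)])
    ultimately have "proj_ext_deg \<rho> k (c *\<^sub>R f) \<le>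
        \<bar>c\<bar> * (\<Sum>i=1..n. \<Prod>j=1..k. \<rho> (g i j))"
      using proj_ext_deg_le[OF assms(1) k n(1), of "c *\<^sub>R f" G] n(2)
      by (simp add: scaleR_sum_right sum_distrib_left)
    also have "\<dots> \<le> \<bar>c\<bar> * r" using n(3) by (intro mult_left_mono) auto
    finally show ?thesis .
  qed
  \<comment> \<open>The bound holds for every \<open>r\<close> above the infimum; let
    \<open>r\<close> decrease to it.\<close>
  moreover have "((\<lambda>r. \<bar>c\<bar> * r) \<longlongrightarrow> \<bar>c\<bar> * proj_ext_deg \<rho> k f) (at_right (proj_ext_deg \<rho> k f))"
    by (intro tendsto_intros)
  ultimately show ?thesis
    by (intro tendsto_lowerbound[where F = "at_right (proj_ext_deg \<rho> k f)"])
      (auto simp: eventually_at_filter)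
qed

lemma proj_ext_deg_zero:
  assumes "seminorm \<rho>"
  shows "proj_ext_deg \<rho> k 0 = 0"
  using proj_ext_deg_scale_le[OF assms, of 0 k 0] proj_ext_deg_nonneg[OF assms, of 0 k]
  by (simp add: symalg_deg_def span_zero)

section \<open>From single degrees to the whole symmetric algebra\<close>

lemma proj_ext_eq_sum:
  assumes "seminorm \<rho>" "finite A" "{k. sym_part k f \<noteq> 0} \<subseteq> A"
  shows "proj_ext \<rho> f = (\<Sum>k\<in>A. proj_ext_deg \<rho> k (sym_part k f))"
  unfolding proj_ext_def using assms(2,3)
  by (intro sum.mono_neutral_left) (auto simp: proj_ext_deg_zero[OF assms(1)])

lemma seminorm_proj_ext:
  fixes \<rho> :: "'v::real_vector \<Rightarrow> real"
  assumes \<rho>: "seminorm \<rho>"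
  shows "seminorm (proj_ext \<rho>)"
proof -
  have scale_le: "proj_ext \<rho> (c *\<^sub>R f) \<le> \<bar>c\<bar> * proj_ext \<rho> f" for c f
  proof -
    let ?A = "{k. sym_part k f \<noteq> 0}"
    have "proj_ext \<rho> (c *\<^sub>R f) = (\<Sum>k\<in>?A. proj_ext_deg \<rho> k (sym_part k (c *\<^sub>R f)))"
      by (intro proj_ext_eq_sum[OF \<rho>] sym_part_decomposition)
        (auto simp: linear_scale[OF linear_sym_part])
    also have "\<dots> \<le> (\<Sum>k\<in>?A. \<bar>c\<bar> * proj_ext_deg \<rho> k (sym_part k f))"
      by (intro sum_mono)
        (simp add: linear_scale[OF linear_sym_part] proj_ext_deg_scale_le[OF \<rho>]
          sym_part_in_symalg_deg)
    finally show ?thesis by (simp add: proj_ext_def sum_distrib_left)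
  qed
  show ?thesis
    unfolding seminorm_def
  proof (intro conjI allI)
    show "0 \<le> proj_ext \<rho> f" for f
      unfolding proj_ext_def
      by (intro sum_nonneg proj_ext_deg_nonneg[OF \<rho>] sym_part_in_symalg_deg)
  next
    fix f g :: "'v symalg"
    \<comment> \<open>Both elements and their sum have their nonzero components in this common index
      set; vanishing components contribute zero.\<close>
    let ?A = "{k. sym_part k f \<noteq> 0} \<union> {k. sym_part k g \<noteq> 0}"
    have A: "finite ?A" by (simp add: sym_part_decomposition)
    have "proj_ext \<rho> (f + g) = (\<Sum>k\<in>?A. proj_ext_deg \<rho> k (sym_part k (f + g)))"
      by (intro proj_ext_eq_sum[OF \<rho> A]) (auto simp: linear_add[OF linear_sym_part])
    also have "\<dots> \<le> (\<Sum>k\<in>?A. proj_ext_deg \<rho> k (sym_part k f) + proj_ext_deg \<rho> k (sym_part k g))"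
      by (intro sum_mono)
        (simp add: linear_add[OF linear_sym_part] proj_ext_deg_triangle[OF \<rho>]
          sym_part_in_symalg_deg)
    also have "\<dots> = proj_ext \<rho> f + proj_ext \<rho> g"
      using proj_ext_eq_sum[OF \<rho> A, of f] proj_ext_eq_sum[OF \<rho> A, of g]
      by (simp add: sum.distrib)
    finally show "proj_ext \<rho> (f + g) \<le> proj_ext \<rho> f + proj_ext \<rho> g" .
  next
    fix c f
    show "proj_ext \<rho> (c *\<^sub>R f) = \<bar>c\<bar> * proj_ext \<rho> f"
    proof (cases "c = 0")
      case True
      then show ?thesis by (simp add: proj_ext_def linear_0[OF linear_sym_part])
    next
      case False
      then show ?thesis
        \<comment> \<open>The second instance gives the reverse inequality, since
          \<open>inverse c\<close> scales \<open>c *\<^sub>R f\<close> back to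
          \<open>f\<close>.\<close>
        using scale_le[of c f] scale_le[of "inverse c" "c *\<^sub>R f"] by (simp add: field_simps)
    qed
  qed
qed

section \<open>Bounds on monomials and maximality of the projective extension\<close>

lemma proj_ext_monomial_le:
  assumes \<rho>: "seminorm \<rho>"
  shows "proj_ext \<rho> (prod_mset (image_mset sym_of M)) \<le> prod_mset (image_mset \<rho> M)"
proof -
  let ?m = "prod_mset (image_mset sym_of M)"
  have "proj_ext \<rho> ?m = (\<Sum>k\<in>{size M}. proj_ext_deg \<rho> k (sym_part k ?m))"
    by (intro proj_ext_eq_sum[OF \<rho>]) (auto simp: sym_part_monomial)
  then have eq: "proj_ext \<rho> ?m = proj_ext_deg \<rho> (size M) ?m" by (simp add: sym_part_monomial)
  show ?thesis
  proof (cases "M = {#}")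
    case True
    then show ?thesis using eq proj_ext_deg_0[of \<rho> 1] by simp
  next
    case False
    obtain xs where M: "M = mset xs" by (metis ex_mset)
    \<comment> \<open>List positions start at 0 and the products at 1, hence the index
      \<open>j - 1\<close>. The identity is used for \<open>sym_of\<close> and for
      \<open>\<rho>\<close>.\<close>
    have prod: "prod_mset (image_mset \<phi> M) = (\<Prod>j=1..size M. \<phi> (xs ! (j - 1)))"
      for \<phi> :: "'a \<Rightarrow> 'c::comm_monoid_mult"
    proof -
      have "prod_mset (image_mset \<phi> M) = prod_list (map \<phi> xs)"
        by (simp add: M flip: prod_mset_prod_list)
      also have "\<dots> = (\<Prod>j=0..<length xs. \<phi> (xs ! j))"
        by (simp add: prod.list_conv_set_nth)
      also have "\<dots> = (\<Prod>j=1..length xs. \<phi> (xs ! (j - 1)))"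
        by (rule prod.reindex_bij_witness[of _ "\<lambda>j. j - 1" Suc]) auto
      finally show ?thesis by (simp add: M)
    qed
    have "1 \<le> size M" using False by (simp add: Suc_le_eq nonempty_has_size)
    \<comment> \<open>The monomial itself is a representation with \<open>n = 1\<close>.\<close>
    from proj_ext_deg_le[OF \<rho> this order.refl, of ?m "\<lambda>_ j. xs ! (j - 1)"] show ?thesis
      unfolding eq by (simp add: prod)
  qed
qed

text \<open>Every representation of a homogeneous \<open>h\<close> bounds \<open>q h\<close> by
  \<open>C\<close> times its sum of products. Taking the infimum gives the bound in each degree, and
  the triangle inequality adds the degrees.\<close>

lemma proj_ext_greatest:
  fixes q :: "'v::real_vector symalg \<Rightarrow> real"
  assumes \<rho>: "seminorm \<rho>" and q: "seminorm q" and C: "0 \<le> C"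
    and le: "\<And>M. q (prod_mset (image_mset sym_of M)) \<le> C * prod_mset (image_mset \<rho> M)"
  shows "q f \<le> C * proj_ext \<rho> f"
proof -
  have deg: "q h \<le> C * proj_ext_deg \<rho> k h" if h: "h \<in> symalg_deg k" for k h
  proof (cases "k = 0")
    case True
    then obtain c where c: "h = of_real c" using symalg_deg_0[of h] h by auto
    have "q h = \<bar>c\<bar> * q 1" by (simp add: c of_real_def seminorm_scale[OF q])
    \<comment> \<open>The empty monomial gives \<open>q 1 \<le> C\<close>.\<close>
    also have "\<dots> \<le> \<bar>c\<bar> * C" using le[of "{#}"] by (intro mult_left_mono) auto
    finally show ?thesis using True c by (simp add: proj_ext_deg_0 mult.commute)
  next
    case False
    then have k: "1 \<le> k" by simp
    have "q h \<le> C * r" if less: "proj_ext_deg \<rho> k h < r" for r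
    proof -
      obtain n and g :: "nat \<Rightarrow> nat \<Rightarrow> 'v" where
        n: "h = (\<Sum>i=1..n. \<Prod>j=1..k. sym_of (g i j))"
          "(\<Sum>i=1..n. \<Prod>j=1..k. \<rho> (g i j)) < r"
        by (rule proj_ext_deg_approx[OF k h less])
      have "q (\<Prod>j=1..k. sym_of (g i j)) \<le> C * (\<Prod>j=1..k. \<rho> (g i j))" for i
        using le[of "image_mset (g i) (mset_set {1..k})"]
        by (simp add: prod_unfold_prod_mset multiset.map_comp comp_def)
      then have "q h \<le> C * (\<Sum>i=1..n. \<Prod>j=1..k. \<rho> (g i j))"
        unfolding n(1) sum_distrib_left by (intro order_trans[OF seminorm_sum[OF q]] sum_mono)
      also have "\<dots> \<le> C * r" using n(2) C by (intro mult_left_mono) auto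
      finally show ?thesis .
    qed
    moreover have "((\<lambda>r. C * r) \<longlongrightarrow> C * proj_ext_deg \<rho> k h) (at_right (proj_ext_deg \<rho> k h))"
      by (intro tendsto_intros)
    ultimately show ?thesis
      by (intro tendsto_lowerbound[where F = "at_right (proj_ext_deg \<rho> k h)"])
        (auto simp: eventually_at_filter)
  qed
  have "q f = q (\<Sum>k | sym_part k f \<noteq> 0. sym_part k f)"
    by (simp flip: sym_part_decomposition(2))
  also have "\<dots> \<le> (\<Sum>k | sym_part k f \<noteq> 0. q (sym_part k f))" by (rule seminorm_sum[OF q])
  also have "\<dots> \<le> C * proj_ext \<rho> f"
    unfolding proj_ext_def sum_distrib_left by (intro sum_mono deg sym_part_in_symalg_deg)
  finally show ?thesis .
qed

text \<open>Maximality is applied twice: first with one factor a fixed monomial, then with that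
  monomial replaced by an arbitrary element.\<close>

lemma submultiplicative_proj_ext:
  assumes \<rho>: "seminorm \<rho>"
  shows "submultiplicative (proj_ext \<rho>)"
proof -
  note sem = seminorm_proj_ext[OF \<rho>]
  have w: "0 \<le> prod_mset (image_mset \<rho> M)" for M
    by (induction M) (auto intro: mult_nonneg_nonneg seminorm_nonneg[OF \<rho>])
  have mon: "proj_ext \<rho> (f * prod_mset (image_mset sym_of N)) \<le>
      prod_mset (image_mset \<rho> N) * proj_ext \<rho> f" for f N
  proof (rule proj_ext_greatest[OF \<rho> _ w])
    show "seminorm (\<lambda>f. proj_ext \<rho> (f * prod_mset (image_mset sym_of N)))"
      by (intro seminorm_compose_linear[OF sem] linearI) (simp_all add: distrib_right)
    show "proj_ext \<rho> (prod_mset (image_mset sym_of M) * prod_mset (image_mset sym_of N)) \<le>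
        prod_mset (image_mset \<rho> N) * prod_mset (image_mset \<rho> M)" for M
      using proj_ext_monomial_le[OF \<rho>, of "M + N"] by (simp add: mult.commute)
  qed
  have "proj_ext \<rho> (f * g) \<le> proj_ext \<rho> f * proj_ext \<rho> g" for f g
  \<comment> \<open>Now \<open>f\<close> is fixed and \<open>C\<close> is
    \<open>proj_ext \<rho> f\<close>; the bound on monomials is \<open>mon\<close>.\<close>
  proof (rule proj_ext_greatest[OF \<rho> _ seminorm_nonneg[OF sem]])
    show "seminorm (\<lambda>g. proj_ext \<rho> (f * g))"
      by (intro seminorm_compose_linear[OF sem] linearI) (simp_all add: distrib_left)
  qed (use mon in \<open>simp add: mult.commute\<close>)
  then show ?thesis by (simp add: submultiplicative_def)
qed

text \<open>The constant \<open>p 1\<close> comes from the empty monomial, where \<open>p\<close>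
  may exceed 1; each further factor \<open>v\<close> costs at most
  \<open>\<sigma> v\<close>.\<close>

lemma submultiplicative_le_proj_ext:
  assumes \<sigma>: "seminorm \<sigma>" and p: "seminorm p" "submultiplicative p"
    and le: "\<And>v. p (sym_of v) \<le> \<sigma> v"
  shows "p f \<le> p 1 * proj_ext \<sigma> f"
proof (rule proj_ext_greatest[OF \<sigma> p(1) seminorm_nonneg[OF p(1)]])
  fix M
  show "p (prod_mset (image_mset sym_of M)) \<le> p 1 * prod_mset (image_mset \<sigma> M)"
  proof (induction M)
    case (add v M)
    have "p (sym_of v * prod_mset (image_mset sym_of M)) \<le>
        p (sym_of v) * p (prod_mset (image_mset sym_of M))"
      using p(2) by (simp add: submultiplicative_def)
    also have "\<dots> \<le> \<sigma> v * (p 1 * prod_mset (image_mset \<sigma> M))"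
      by (intro mult_mono le add seminorm_nonneg[OF \<sigma>] seminorm_nonneg[OF p(1)])
    finally show ?case by (simp add: mult_ac)
  qed simp
qed

text \<open>For the lower bound, injectivity of \<open>sym_of\<close> turns a degree 1
  representation into a decomposition of \<open>v\<close> inside \<open>V\<close>, where the
  triangle inequality for \<open>\<rho>\<close> applies.\<close>

lemma proj_ext_sym_of:
  fixes \<rho> :: "'v::real_vector \<Rightarrow> real"
  assumes \<rho>: "seminorm \<rho>"
  shows "proj_ext \<rho> (sym_of v) = \<rho> v"
proof (rule antisym)
  show "proj_ext \<rho> (sym_of v) \<le> \<rho> v" using proj_ext_monomial_le[OF \<rho>, of "{#v#}"] by simp
  have deg: "sym_of v \<in> symalg_deg 1" using monomial_in_symalg_deg[of "{#v#}"] by simp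
  then have "proj_ext \<rho> (sym_of v) = (\<Sum>k\<in>{1}. proj_ext_deg \<rho> k (sym_part k (sym_of v)))"
    by (intro proj_ext_eq_sum[OF \<rho>]) (auto simp: sym_part_symalg_deg)
  then have eq: "proj_ext \<rho> (sym_of v) = proj_ext_deg \<rho> 1 (sym_of v)"
    using deg by (simp add: sym_part_symalg_deg)
  show "\<rho> v \<le> proj_ext \<rho> (sym_of v)"
  proof (rule ccontr)
    assume "\<not> ?thesis"
    then have less: "proj_ext_deg \<rho> 1 (sym_of v) < \<rho> v" by (simp only: eq not_le)
    obtain n and g :: "nat \<Rightarrow> nat \<Rightarrow> 'v" where
      g: "sym_of v = (\<Sum>i=1..n. \<Prod>j=1..1. sym_of (g i j))"
        "(\<Sum>i=1..n. \<Prod>j=1..1. \<rho> (g i j)) < \<rho> v"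
      by (rule proj_ext_deg_approx[OF order.refl deg less])
    from g(1) have "sym_of v = sym_of (\<Sum>i=1..n. g i 1)"
      by (simp add: linear_sum[OF sym_of_linear])
    then have "v = (\<Sum>i=1..n. g i 1)" by (rule injD[OF inj_sym_of])
    then show False using seminorm_sum[OF \<rho>, of "\<lambda>i. g i 1" "{1..n}"] g(2) by simp
  qed
qed

section \<open>The topology of the projective extensions\<close>

lemma lmc_topology_proj_ext_topology:
  assumes "\<forall>\<rho>\<in>S. seminorm \<rho>"
  shows "lmc_topology (proj_ext_topology S)"
  unfolding lmc_topology_def proj_ext_topology_def
proof (intro exI conjI ballI)
  fix p assume "p \<in> {proj_ext (\<lambda>v. real i * \<rho> v) | i \<rho>. i \<ge> 1 \<and> \<rho> \<in> S}"
  then obtain i \<rho> where p: "p = proj_ext (\<lambda>v. real i * \<rho> v)" "\<rho> \<in> S" by auto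
  then have "seminorm (\<lambda>v. real i * \<rho> v)" using assms by (simp add: seminorm_real_mult)
  then show "seminorm p" "submultiplicative p"
    unfolding p by (rule seminorm_proj_ext, rule submultiplicative_proj_ext)
qed (rule refl)

text \<open>This shows that the induced topology is coarser than the original one. The centre
  \<open>a\<close> need not lie in the image of \<open>V\<close>, so a Lipschitz estimate with
  constant \<open>i\<close> is used instead of pulling back a ball directly.\<close>

lemma continuous_map_sym_of:
  assumes "\<forall>\<rho>\<in>S. seminorm \<rho>"
  shows "continuous_map (seminorm_topology S) (proj_ext_topology S) sym_of"
  unfolding proj_ext_topology_def
proof (rule continuous_map_seminorm_topology)
  fix p and a :: "'a symalg" and e :: real
  assume "p \<in> {proj_ext (\<lambda>v. real i * \<rho> v) | i \<rho>. i \<ge> 1 \<and> \<rho> \<in> S}"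
  then obtain i \<rho> where p: "p = proj_ext (\<lambda>v. real i * \<rho> v)" and \<rho>: "\<rho> \<in> S" by auto
  have sem: "seminorm (\<lambda>v. real i * \<rho> v)" using assms \<rho> by (simp add: seminorm_real_mult)
  have "p (sym_of y - a) \<le> p (sym_of x - a) + real i * \<rho> (y - x)" for x y
    using seminorm_triangle[OF seminorm_proj_ext[OF sem], of "sym_of x - a" "sym_of (y - x)"]
    by (simp add: p proj_ext_sym_of[OF sem]) (simp add: linear_diff[OF sym_of_linear])
  then show "openin (seminorm_topology S) {x. p (sym_of x - a) < e}"
    using \<rho> assms by (intro openin_sublevel_seminorm_topology[of \<rho> _ "real i"]) auto
qed simp

lemma extends_topology_proj_ext_topology:
  assumes "\<forall>\<rho>\<in>S. seminorm \<rho>"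
  shows "extends_topology (proj_ext_topology S) (seminorm_topology S)"
  unfolding extends_topology_def
proof (rule topology_eq[THEN iffD2], intro allI iffI)
  let ?T = "pullback_topology UNIV sym_of (proj_ext_topology S)"
  fix U
  {
    assume "openin ?T U"
    then obtain W where W: "openin (proj_ext_topology S) W" "U = sym_of -` W"
      by (auto simp: openin_pullback_topology)
    from openin_continuous_map_preimage[OF continuous_map_sym_of[OF assms] W(1)]
    show "openin (seminorm_topology S) U" by (simp add: W(2) vimage_def)
  next
    assume U: "openin (seminorm_topology S) U"
    \<comment> \<open>Conversely, each ball in \<open>V\<close> is the trace of a ball of
      \<open>proj_ext p\<close>, the member of the family with \<open>i = 1\<close>.\<close>
    have "continuous_map ?T (seminorm_topology S) id"
    proof (rule continuous_map_seminorm_topology)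
      fix p and a :: 'a and e :: real assume p: "p \<in> S" and e: "0 < e"
      have sem: "seminorm p" using p assms by simp
      have "openin (proj_ext_topology S) {f. proj_ext p (f - sym_of a) < e}"
        unfolding proj_ext_topology_def using p e
        by (intro openin_seminorm_ball) (auto intro!: exI[of _ 1] exI[of _ p])
      moreover have "{x. p (id x - a) < e} = sym_of -` {f. proj_ext p (f - sym_of a) < e}"
        by (simp add: vimage_def proj_ext_sym_of[OF sem] flip: linear_diff[OF sym_of_linear])
      ultimately show "openin ?T {x. p (id x - a) < e}"
        by (auto simp: openin_pullback_topology)
    qed (simp add: topspace_pullback_topology proj_ext_topology_def)
    from openin_continuous_map_preimage[OF this U]
    show "openin ?T U" by (simp add: topspace_pullback_topology proj_ext_topology_def)
  }
qed

text \<open>Each seminorm \<open>q\<close> generating \<open>T\<close> is shown to be dominated by a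
  multiple of a single generator of the projective topology.\<close>

lemma proj_ext_topology_finest:
  fixes T :: "'v::real_vector symalg topology"
  assumes S: "\<forall>\<rho>\<in>S. seminorm \<rho>" "directed_family S"
    and T: "lmc_topology T" "extends_topology T (seminorm_topology S)"
    and U: "openin T U"
  shows "openin (proj_ext_topology S) U"
proof -
  obtain Q where Q: "\<forall>q\<in>Q. seminorm q \<and> submultiplicative q" "T = seminorm_topology Q"
    using T(1) unfolding lmc_topology_def by auto
  show ?thesis
    unfolding proj_ext_topology_def
  proof (rule seminorm_topology_coarser)
    show "openin (seminorm_topology Q) U" using U Q(2) by simp
  next
    fix q and a :: "'v symalg" and e :: real assume q: "q \<in> Q"
    have qs: "seminorm q" "submultiplicative q" using Q(1) q by auto
    have "openin T {f. q (f - 0) < 1}" unfolding Q(2) by (rule openin_seminorm_ball[OF q]) simp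
    then have "openin (pullback_topology UNIV sym_of T) (sym_of -` {f. q (f - 0) < 1})"
      by (auto simp: openin_pullback_topology)
    then have "openin (seminorm_topology S) (sym_of -` {f. q (f - 0) < 1})"
      using T(2) by (simp add: extends_topology_def)
    moreover have "0 \<in> sym_of -` {f. q (f - 0) < 1}"
      by (simp add: linear_0[OF sym_of_linear] seminorm_zero[OF qs(1)])
    ultimately have "\<exists>\<rho>\<in>S. \<exists>d>0. {v. \<rho> (v - 0) < d} \<subseteq> sym_of -` {f. q (f - 0) < 1}"
      by (rule directed_seminorm_topology_ball[OF S])
    then obtain \<rho> d where \<rho>: "\<rho> \<in> S" and d: "0 < d" and
      ball: "{v. \<rho> v < d} \<subseteq> sym_of -` {f. q f < 1}" by auto
    have \<rho>s: "seminorm \<rho>" using S(1) \<rho> by simp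
    \<comment> \<open>The bound \<open>2 / d\<close> is the domination constant for a ball of radius
      \<open>d\<close>; the bound \<open>1\<close> puts the index in the admissible range.\<close>
    obtain i where i: "max 1 (2 / d) \<le> real i"
      using real_arch_simple[of "max 1 (2 / d)"] by (elim exE)
    have "q (sym_of v) \<le> real i * \<rho> v" for v
    proof -
      have "q (sym_of v) \<le> 2 / d * \<rho> v"
        by (rule seminorm_dominated_of_ball[OF seminorm_compose_linear[OF qs(1) sym_of_linear] \<rho>s d])
          (use ball in auto)
      also have "\<dots> \<le> real i * \<rho> v"
        using i by (intro mult_right_mono seminorm_nonneg[OF \<rho>s]) simp
      finally show ?thesis .
    qed
    moreover have sem: "seminorm (\<lambda>v. real i * \<rho> v)" by (simp add: seminorm_real_mult[OF \<rho>s])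
    ultimately have le: "q f \<le> q 1 * proj_ext (\<lambda>v. real i * \<rho> v) f" for f
      by (intro submultiplicative_le_proj_ext qs)
    show "openin (seminorm_topology {proj_ext (\<lambda>v. real i * \<rho> v) | i \<rho>. i \<ge> 1 \<and> \<rho> \<in> S})
        {x. q (x - a) < e}"
    \<comment> \<open>The Lipschitz constant is \<open>q 1\<close>, so balls of \<open>q\<close>
      around any centre are open.\<close>
    proof (rule openin_sublevel_seminorm_topology)
      show "proj_ext (\<lambda>v. real i * \<rho> v) \<in> {proj_ext (\<lambda>v. real i * \<rho> v) | i \<rho>. i \<ge> 1 \<and> \<rho> \<in> S}"
        using i \<rho> by auto
      show "q (y - a) \<le> q (x - a) + q 1 * proj_ext (\<lambda>v. real i * \<rho> v) (y - x)" for x y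
        using seminorm_triangle[OF qs(1), of "x - a" "y - x"] le[of "y - x"] by simp
    qed (rule seminorm_proj_ext[OF sem] seminorm_nonneg[OF qs(1)])+
  qed
qed

theorem proposition5p1:
  fixes S :: "('v::real_vector \<Rightarrow> real) set"
    and \<tau> :: "'v topology"
  assumes "\<forall>\<rho>\<in>S. seminorm \<rho>"
    and "directed_family S"
    and "\<tau> = seminorm_topology S"
  shows "lmc_topology (proj_ext_topology S) \<and>
         extends_topology (proj_ext_topology S) \<tau> \<and>
         (\<forall>T. lmc_topology T \<and> extends_topology T \<tau> \<longrightarrow>
           (\<forall>U. openin T U \<longrightarrow> openin (proj_ext_topology S) U))"
  unfolding assms(3)
  using lmc_topology_proj_ext_topology[OF assms(1)] extends_topology_proj_ext_topology[OF assms(1)]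
    proj_ext_topology_finest[OF assms(1,2)]
  by (intro conjI allI impI) auto

end
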